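(* Let $M=(E,r)$ be a $q$-matroid with cyclic operator $\mathrm{cyc}$. For all subspaces $A,B\le E$: (cyc1) $\mathrm{cyc}(A)\le A$; (cyc2) if $A\le B$ then $\mathrm{cyc}(A)\le\mathrm{cyc}(B)$; (cyc3) $\mathrm{cyc}(\mathrm{cyc}(A))=\mathrm{cyc}(A)$.
   Context: Let $q$ be a prime power and $E$ an $n$-dimensional $\mathbb{F}_q$-vector space. A $q$-matroid $(E,r)$ is a function $r$ from subspaces of $E$ to $\mathbb{Z}$ with (R1) $0\le r(A)\le\dim A$, (R2) $r(A)\le r(B)$ if $A\le B$, (R3) $r(A+B)+r(A\cap B)\le r(A)+r(B)$. For $A\le E$, let $\mathrm{Cyc}(A)$ be the set of $1$-dimensional subspaces $x\le A$ such that $r(B+x)=r(B)$ for every subspace $B\le A$ of codimension $1$ in $A$, and define $\mathrm{cyc}(A)=\sum_{x\in\mathrm{Cyc}(A)}x$ (the zero space if the set is empty). *)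

theory Defs
  imports Complex_Main "HOL-Library.FuncSet" "HOL-Library.Set_Algebras"
begin

text \<open>
  The ground space \<open>E\<close> is the whole type of vectors and the field is a finite field type, so the
  field has prime power order \<open>q\<close>.  A rank function is a function on all sets of vectors, of which
  only the values on subspaces are constrained or used.  The sum \<open>A + B\<close> of subspaces is the
  elementwise sum of sets from \<open>HOL-Library.Set_Algebras\<close>.
\<close>

locale q_matroid = finite_dimensional_vector_space scale Basis
  for scale :: "'k::{field, finite} \<Rightarrow> 'v::ab_group_add \<Rightarrow> 'v" (infixr \<open>*s\<close> 75)
    and Basis :: "'v set" +
  fixes r :: "'v set \<Rightarrow> int"
  assumes rank_nonneg: "subspace A \<Longrightarrow> 0 \<le> r A"
    and rank_le_dim: "subspace A \<Longrightarrow> r A \<le> int (dim A)"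
    and rank_mono: "subspace A \<Longrightarrow> subspace B \<Longrightarrow> A \<subseteq> B \<Longrightarrow> r A \<le> r B"
    and rank_submodular: "subspace A \<Longrightarrow> subspace B \<Longrightarrow> r (A + B) + r (A \<inter> B) \<le> r A + r B"

context q_matroid
begin

definition Cyc :: "'v set \<Rightarrow> 'v set set" where
  "Cyc A = {x. subspace x \<and> dim x = 1 \<and> x \<subseteq> A \<and>
     (\<forall>B. subspace B \<and> B \<subseteq> A \<and> dim A = dim B + 1 \<longrightarrow> r (B + x) = r B)}"

text \<open>
  The sum of a family of subspaces is the span of its union; for the empty family this is the
  zero space.  It is also the iterated sum of sets, see \<open>cyc_eq_sum\<close>.
\<close>

definition cyc :: "'v set \<Rightarrow> 'v set" where
  "cyc A = span (\<Union>x\<in>Cyc A. x)"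

lemma span_Union_eq_sum:
  assumes "finite F" and "\<And>x. x \<in> F \<Longrightarrow> subspace x"
  shows "span (\<Union>x\<in>F. x) = (\<Sum>x\<in>F. x)"
  using assms
proof (induction F rule: finite_induct)
  case empty
  then show ?case by (simp add: set_zero)
next
  case (insert a F)
  have "span (\<Union>x\<in>insert a F. x) = span a + span (\<Union>x\<in>F. x)"
    by (auto simp: span_Un set_plus_def)
  also have "span a = a"
    using insert.prems[of a] by (simp add: span_eq_iff)
  also have "span (\<Union>x\<in>F. x) = (\<Sum>x\<in>F. x)"
    using insert.IH insert.prems by simp
  finally show ?case
    using insert.hyps by simp
qed

lemma finite_ground_space: "finite (UNIV :: 'v set)"
proof -
  have "v \<in> (\<lambda>c. \<Sum>b\<in>Basis. c b *s b) ` (Basis \<rightarrow>\<^sub>E UNIV)" for v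
  proof -
    have "v \<in> range (\<lambda>c. \<Sum>b\<in>Basis. c b *s b)"
      using span_finite[OF finite_Basis] span_Basis by blast
    then obtain c where c: "v = (\<Sum>b\<in>Basis. c b *s b)"
      by blast
    have "v = (\<Sum>b\<in>Basis. restrict c Basis b *s b)"
      unfolding c by (rule sum.cong) auto
    then show ?thesis
      by (rule image_eqI[where x = "restrict c Basis"]) auto
  qed
  then have "UNIV \<subseteq> (\<lambda>c. \<Sum>b\<in>Basis. c b *s b) ` (Basis \<rightarrow>\<^sub>E (UNIV :: 'k set))"
    by blast
  moreover have "finite (Basis \<rightarrow>\<^sub>E (UNIV :: 'k set))"
    by (intro finite_PiE finite_Basis finite)
  ultimately show ?thesis
    by (rule finite_subset[OF _ finite_imageI])
qed

lemma cyc_eq_sum: "cyc A = (\<Sum>x\<in>Cyc A. x)"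
proof -
  have "finite (UNIV :: 'v set set)"
    using finite_ground_space by (simp add: Finite_Set.finite_set)
  then have "finite (Cyc A)"
    by (rule finite_subset[OF subset_UNIV])
  then show ?thesis
    unfolding cyc_def by (rule span_Union_eq_sum) (simp add: Cyc_def)
qed

end

end

theory Submission
  imports Defs
begin

text \<open>
  The nullity \<open>dim A - r A\<close> is monotone and supermodular, so the subspaces of \<open>A\<close> with the same
  nullity as \<open>A\<close> are closed under intersection and have a least element, the core of \<open>A\<close>.  A line
  lies in \<open>Cyc A\<close> iff it lies in every hyperplane of \<open>A\<close> with the same nullity as \<open>A\<close>; since a
  subspace is the intersection of the hyperplanes containing it, \<open>cyc A\<close> is the core of \<open>A\<close>.
  Idempotence holds because a subspace and its core have the same nullity, and monotonicity
  follows from supermodularity.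
\<close>

section \<open>Sums of subspaces, complements and hyperplanes\<close>

context finite_dimensional_vector_space
begin

lemma set_plus_eq: "S + T = {x + y |x y. x \<in> S \<and> y \<in> T}"
  by (auto simp: set_plus_def)

lemma subspace_set_plus: "subspace S \<Longrightarrow> subspace T \<Longrightarrow> subspace (S + T)"
  by (auto simp: set_plus_eq intro: subspace_sums)

lemma set_plus_least: "subspace U \<Longrightarrow> S \<subseteq> U \<Longrightarrow> T \<subseteq> U \<Longrightarrow> S + T \<subseteq> U"
  by (auto simp: set_plus_def intro: subspace_add)

lemma subset_set_plus_left: "subspace T \<Longrightarrow> S \<subseteq> S + T"
  using set_zero_plus2[of T S] subspace_0[of T] by (simp add: add.commute)

lemma subset_set_plus_right: "subspace S \<Longrightarrow> T \<subseteq> S + T"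
  by (rule set_zero_plus2) (rule subspace_0)

lemma dim_set_plus_Int:
  assumes "subspace S" and "subspace T"
  shows "dim (S + T) + dim (S \<inter> T) = dim S + dim T"
  using dim_sums_Int[OF assms] by (simp add: set_plus_eq)

text \<open>Extend a basis of \<open>S\<close> to a basis of \<open>T\<close>; the added vectors
  span \<open>W\<close>.\<close>

lemma subspace_complement_sum:
  assumes "subspace S" and "subspace T" and "S \<subseteq> T"
  obtains W where "subspace W" and "T = S + W" and "dim S + dim W \<le> dim T"
proof -
  obtain B where B: "B \<subseteq> S" "independent B" "S \<subseteq> span B" "card B = dim S"
    by (rule basis_exists)
  have "B \<subseteq> T"
    using B(1) assms(3) by (rule subset_trans)
  then obtain C where C: "B \<subseteq> C" "C \<subseteq> T" "independent C" "T \<subseteq> span C"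
    using maximal_independent_subset_extend B(2) by metis
  have spans: "span B = S" "span C = T"
    using span_subspace[OF B(1,3) assms(1)] span_subspace[OF C(2,4) assms(2)] by blast+
  have "finite C"
    using C(3) by (rule finiteI_independent)
  have card_C: "card C = dim T"
    using C by (intro basis_card_eq_dim)
  have "T = span (B \<union> (C - B))"
    using C(1) spans(2) by (simp add: Un_absorb1)
  also have "\<dots> = S + span (C - B)"
    unfolding span_Un spans(1) set_plus_eq ..
  finally have "T = S + span (C - B)" .
  moreover have "dim (span (C - B)) \<le> card (C - B)"
    using \<open>finite C\<close> by (simp add: dim_le_card')
  then have "dim S + dim (span (C - B)) \<le> dim T"
    using B(4) card_mono[OF \<open>finite C\<close> C(1)] card_C card_Diff_subset[OF _ C(1)]
      finite_subset[OF C(1) \<open>finite C\<close>]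
    by linarith
  ultimately show thesis
    using that subspace_span by blast
qed

text \<open>Extend a basis of \<open>S\<close> together with \<open>v\<close> to a basis of
  \<open>A\<close>, then delete \<open>v\<close>: the remaining vectors span \<open>H\<close>, which
  misses \<open>v\<close> by independence.\<close>

lemma separating_hyperplane_exists:
  assumes "subspace S" and "subspace A" and "S \<subseteq> A" and "v \<in> A" and "v \<notin> S"
  obtains H where "subspace H" and "H \<subseteq> A" and "dim A = dim H + 1" and "S \<subseteq> H" and "v \<notin> H"
proof -
  obtain B where B: "B \<subseteq> S" "independent B" "S \<subseteq> span B"
    by (rule basis_exists)
  have "span B = S"
    using span_subspace[OF B(1,3) assms(1)] .
  then have "independent (insert v B)"
    using B(2) assms(5) by (simp add: independent_insert)
  moreover have "insert v B \<subseteq> A"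
    using B(1) assms(3,4) by blast
  ultimately obtain C where C: "insert v B \<subseteq> C" "C \<subseteq> A" "independent C" "A \<subseteq> span C"
    using maximal_independent_subset_extend by metis
  have "finite C"
    using C(3) by (rule finiteI_independent)
  have "v \<notin> B"
    using B(1) assms(5) by blast
  let ?H = "span (C - {v})"
  have "v \<notin> ?H"
    using C(1,3) by (auto simp: dependent_def)
  moreover have "S \<subseteq> ?H"
    using B(3) C(1) \<open>v \<notin> B\<close> span_mono[of B "C - {v}"] by blast
  moreover have "?H \<subseteq> A"
    using C(2) assms(2) by (intro span_minimal) auto
  moreover have "independent (C - {v})"
    using C(3) by (rule independent_mono) blast
  then have "dim ?H = card C - 1"
    using C(1) \<open>finite C\<close> by (simp add: dim_eq_card_independent)
  moreover have "dim A = card C"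
    using C by (metis basis_card_eq_dim)
  \<comment> \<open>Guards the truncated subtraction in \<open>card C - 1\<close>.\<close>
  moreover have "card C \<noteq> 0"
    using C(1) \<open>finite C\<close> by auto
  ultimately show thesis
    using that[of ?H] by simp
qed

end

section \<open>Nullity and the core\<close>

context q_matroid
begin

definition nullity :: "'v set \<Rightarrow> int" where
  "nullity S = int (dim S) - r S"

definition core :: "'v set \<Rightarrow> 'v set" where
  "core A = \<Inter>{S. subspace S \<and> S \<subseteq> A \<and> nullity S = nullity A}"

text \<open>By submodularity, passing from \<open>S\<close> to \<open>T = S + W\<close> raises the
  rank by at most \<open>r W \<le> dim W\<close>, and the dimension grows by at least
  \<open>dim W\<close>.\<close>

lemma nullity_mono:
  assumes "subspace S" and "subspace T" and "S \<subseteq> T"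
  shows "nullity S \<le> nullity T"
proof -
  obtain W where W: "subspace W" "T = S + W" "dim S + dim W \<le> dim T"
    using assms by (rule subspace_complement_sum)
  have "r T + r (S \<inter> W) \<le> r S + r W"
    using rank_submodular[OF assms(1) W(1)] W(2) by simp
  moreover have "0 \<le> r (S \<inter> W)"
    using assms(1) W(1) by (intro rank_nonneg subspace_inter)
  ultimately show ?thesis
    using rank_le_dim[OF W(1)] W(3) by (simp add: nullity_def)
qed

lemma nullity_supermodular:
  assumes "subspace S" and "subspace T"
  shows "nullity S + nullity T \<le> nullity (S + T) + nullity (S \<inter> T)"
  using rank_submodular[OF assms] dim_set_plus_Int[OF assms] by (simp add: nullity_def)

text \<open>Since \<open>A + S\<close> lies in \<open>B\<close>, its nullity is at most that of
  \<open>S\<close>, and supermodularity leaves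
  \<open>nullity A \<le> nullity (A \<inter> S)\<close>. This gives both closure under intersection
  and monotonicity of the core.\<close>

lemma nullity_Int_eq:
  assumes A: "subspace A" and B: "subspace B" "A \<subseteq> B"
    and S: "subspace S" "S \<subseteq> B" "nullity S = nullity B"
  shows "nullity (A \<inter> S) = nullity A"
proof (rule antisym)
  show "nullity (A \<inter> S) \<le> nullity A"
    using A S(1) by (intro nullity_mono subspace_inter) auto
  have "nullity (A + S) \<le> nullity B"
    using A B S by (intro nullity_mono subspace_set_plus set_plus_least)
  then show "nullity A \<le> nullity (A \<inter> S)"
    using nullity_supermodular[OF A S(1)] S(3) by simp
qed

lemma core_least:
  "subspace S \<Longrightarrow> S \<subseteq> A \<Longrightarrow> nullity S = nullity A \<Longrightarrow> core A \<subseteq> S"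
  by (auto simp: core_def)

text \<open>The family defining the core is finite, nonempty and closed under binary intersection,
  so it contains its own intersection.\<close>

lemma core_spec:
  assumes "subspace A"
  shows subspace_core: "subspace (core A)"
    and core_subset: "core A \<subseteq> A"
    and nullity_core: "nullity (core A) = nullity A"
proof -
  let ?F = "{S. subspace S \<and> S \<subseteq> A \<and> nullity S = nullity A}"
  have "finite (UNIV :: 'v set set)"
    using finite_ground_space by (simp add: Finite_Set.finite_set)
  then have "finite ?F"
    by (rule finite_subset[OF subset_UNIV])
  moreover have "?F \<noteq> {}"
    using assms by blast
  moreover have "S \<inter> T \<in> ?F" if "S \<in> ?F" and "T \<in> ?F" for S T
    using that assms nullity_Int_eq[of S A T] by (auto intro: subspace_inter)
  ultimately have "core A \<in> ?F"
    unfolding core_def by (rule finite_Inf_in)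
  then show "subspace (core A)" "core A \<subseteq> A" "nullity (core A) = nullity A"
    by auto
qed

text \<open>The subspace \<open>A \<inter> core B\<close> has the nullity of \<open>A\<close>, so it
  belongs to the family defining \<open>core A\<close>.\<close>

lemma core_mono:
  assumes "subspace A" and "subspace B" and "A \<subseteq> B"
  shows "core A \<subseteq> core B"
proof -
  have "core A \<subseteq> A \<inter> core B"
    using assms core_spec[OF assms(2)] nullity_Int_eq[of A B "core B"]
    by (intro core_least) (auto intro: subspace_inter)
  then show ?thesis
    by blast
qed

lemma core_core:
  assumes "subspace A"
  shows "core (core A) = core A"
proof -
  note C = core_spec[OF assms]
  note CC = core_spec[OF C(1)]
  have "core A \<subseteq> core (core A)"
    using CC(1) subset_trans[OF CC(2) C(2)] CC(3)[unfolded C(3)] by (rule core_least)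
  then show ?thesis
    using CC(2) by blast
qed

section \<open>The core as the span of the lines in \<open>Cyc A\<close>\<close>

lemma Cyc_subset_core:
  assumes A: "subspace A" and x: "x \<in> Cyc A"
  shows "x \<subseteq> core A"
proof
  fix v assume "v \<in> x"
  have sx: "subspace x" "x \<subseteq> A"
    and rx: "\<And>B. subspace B \<Longrightarrow> B \<subseteq> A \<Longrightarrow> dim A = dim B + 1 \<Longrightarrow> r (B + x) = r B"
    using x by (auto simp: Cyc_def)
  show "v \<in> core A"
  proof (rule ccontr)
    assume "v \<notin> core A"
    \<comment> \<open>The hyperplane \<open>H\<close> contains the core but not \<open>v\<close>, so
      \<open>H + x = A\<close> and the condition on \<open>x\<close> forces
      \<open>r H = r A\<close>.\<close>
    then obtain H where H: "subspace H" "H \<subseteq> A" "dim A = dim H + 1" "core A \<subseteq> H" "v \<notin> H"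
      using separating_hyperplane_exists[of "core A" A v] core_spec[OF A] A \<open>v \<in> x\<close> sx by blast
    have Hx: "subspace (H + x)" "H + x \<subseteq> A" "H \<subseteq> H + x" "x \<subseteq> H + x"
      using H(1,2) A sx
      by (simp_all add: subspace_set_plus set_plus_least subset_set_plus_left subset_set_plus_right)
    then have "H \<subset> H + x"
      using \<open>v \<in> x\<close> H(5) by blast
    then have "dim H < dim (H + x)"
      using H(1) Hx(1) by (intro dim_psubset) (simp add: span_eq_iff[THEN iffD2])
    then have "H + x = A"
      using H(3) Hx(1,2) A by (intro subspace_dim_equal) auto
    then have "r H = r A"
      using rx[OF H(1-3)] by simp
    \<comment> \<open>\<open>H\<close> lies above the core, which has the nullity of
      \<open>A\<close>; but equal ranks in codimension 1 would give
      \<open>nullity H = nullity A - 1\<close>.\<close>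
    moreover have "nullity A \<le> nullity H"
      using nullity_mono[OF core_spec(1)[OF A] H(1,4)] nullity_core[OF A] by simp
    ultimately show False
      using H(3) by (simp add: nullity_def)
  qed
qed

text \<open>A hyperplane of \<open>A\<close> containing \<open>v\<close> absorbs the line; one
  missing \<open>v\<close> does not contain the core, and then it already has the full rank
  \<open>r A\<close>.\<close>

lemma span_core_in_Cyc:
  assumes A: "subspace A" and v: "v \<in> core A" "v \<noteq> 0"
  shows "span {v} \<in> Cyc A"
proof -
  have vA: "span {v} \<subseteq> A"
    using core_subset[OF A] v(1) A by (intro span_minimal) auto
  have "dim (span {v}) = 1"
    using v(2) by (simp add: dim_eq_card_independent)
  moreover have "r (B + span {v}) = r B" if B: "subspace B" "B \<subseteq> A" "dim A = dim B + 1" for B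
  proof (cases "v \<in> B")
    case True
    then have "span {v} \<subseteq> B"
      using B(1) by (intro span_minimal) auto
    then have "B + span {v} = B"
      using set_plus_least[of B B "span {v}"] subset_set_plus_left[of "span {v}" B] B(1) by auto
    then show ?thesis
      by simp
  next
    case False
    then have "nullity B \<noteq> nullity A"
      using core_least[OF B(1,2)] v(1) by blast
    \<comment> \<open>Nullity drops by at least 1 from \<open>A\<close> to \<open>B\<close> and
      dimension by exactly 1, so the rank cannot drop.\<close>
    then have "r A \<le> r B"
      using nullity_mono[OF B(1) A B(2)] B(3) by (simp add: nullity_def)
    moreover have "r B \<le> r (B + span {v})"
      using B(1) by (intro rank_mono subspace_set_plus subset_set_plus_left subspace_span)
    moreover have "r (B + span {v}) \<le> r A"
      using A B(1,2) vA by (intro rank_mono subspace_set_plus set_plus_least subspace_span)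
    ultimately show ?thesis
      by simp
  qed
  ultimately show ?thesis
    using vA by (simp add: Cyc_def)
qed

lemma cyc_eq_core:
  assumes "subspace A"
  shows "cyc A = core A"
proof
  show "cyc A \<subseteq> core A"
    unfolding cyc_def
    using Cyc_subset_core[OF assms] subspace_core[OF assms] by (intro span_minimal UN_least)
  show "core A \<subseteq> cyc A"
  proof
    fix v assume v: "v \<in> core A"
    show "v \<in> cyc A"
    \<comment> \<open>The zero vector spans no line, so it is treated apart.\<close>
    proof (cases "v = 0")
      case True
      then show ?thesis
        by (simp add: cyc_def span_zero)
    next
      case False
      then show ?thesis
        unfolding cyc_def using span_core_in_Cyc[OF assms v] span_base[of v "{v}"]
        by (intro span_base) blast
    qed
  qed
qed

end

theorem theorem2p8:
  fixes scale :: "'k::{field, finite} \<Rightarrow> 'v::ab_group_add \<Rightarrow> 'v"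
    and Basis :: "'v set"
    and r :: "'v set \<Rightarrow> int"
    and A B :: "'v set"
  assumes "q_matroid scale Basis r"
    and "module.subspace scale A"
    and "module.subspace scale B"
  shows "q_matroid.cyc scale r A \<subseteq> A
    \<and> (A \<subseteq> B \<longrightarrow> q_matroid.cyc scale r A \<subseteq> q_matroid.cyc scale r B)
    \<and> q_matroid.cyc scale r (q_matroid.cyc scale r A) = q_matroid.cyc scale r A"
proof -
  interpret q_matroid scale Basis r
    by (rule assms(1))
  show ?thesis
    using assms(2,3)
    \<comment> \<open>\<open>subspace_core\<close> allows \<open>cyc_eq_core\<close> to rewrite the
      outer \<open>cyc\<close> in (cyc3) as well.\<close>
    by (simp add: cyc_eq_core core_subset core_mono core_core subspace_core)
qed

end
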